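(* Let $M\subset\mathbb{R}^4$, $\varphi\colon\mathbb{R}^4\to\mathbb{R}^2$ and $D\varphi\colon\mathbb{R}^4\to\mathbb{R}^{2\times4}$ be as defined in the context. (a) We have $\varphi(a,b,\mu,\nu)=0$ if and only if $(a,b,\mu,\nu)\in M$. (b) The function $\varphi$ is Newton differentiable of order $\infty$ on $M$ (with Newton derivative $D\varphi$). (c) The function $\varphi$ is not continuous in any open neighborhood of $M$. (d) The function $\varphi$ is calm at every point $\bar w=(\bar a,\bar b,\bar\mu,\bar\nu)\in M$ with calmness modulus $1$, i.e., there is a neighborhood $U$ of $\bar w$ such that $\|\varphi(w)-\varphi(\bar w)\|\le\|w-\bar w\|$ for all $w\in U$. (e) If the sequence $(w_k)_{k\in\mathbb{N}}\subset\mathbb{R}^4$ satisfies $\varphi(w_k)\to0$ and $w_k\to\bar w\in\mathbb{R}^4$, then $\varphi(\bar w)=0$.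
   Context: $\|\cdot\|$ is the Euclidean norm, $e_i$ is the $i$-th unit vector of $\mathbb{R}^4$. The set $M$ is $$M=\{(a,b,\mu,\nu)\in\mathbb{R}^4: a\ge0,\ b\ge0,\ ab=0,\ a\mu=0,\ b\nu=0,\ (\mu\nu=0\ \text{or}\ (\mu<0\text{ and }\nu<0))\}.$$ For $w=(a,b,\mu,\nu)\in\mathbb{R}^4$ let $\psi_1(w)=\max(-a,|b|,|\mu|)$, $\psi_2(w)=\max(-b,|a|,|\nu|)$, $\psi_3(w)=\max(|a|,|b|,\mu,\nu)$, $\varphi_1(w)=\min(\psi_1(w),\psi_2(w),\psi_3(w))$. Let $\sigma(s)=1$ if $s\ge0$ and $\sigma(s)=-1$ if $s<0$. $D\varphi_1(w)\in\mathbb{R}^{1\times4}$ is defined as follows (priority to first-listed entries): let $i$ be the smallest index with $\psi_i(w)=\varphi_1(w)$, and take the first argument of the maximum defining $\psi_i(w)$ which attains this maximum, where the arguments are ordered as $-a,|b|,|\mu|$ for $i=1$, as $-b,|a|,|\nu|$ for $i=2$, and as $|a|,|b|,\mu,\nu$ for $i=3$; $D\varphi_1(w)$ is $-e_1^\top$, $\sigma(a)e_1^\top$, $-e_2^\top$, $\sigma(b)e_2^\top$, $e_3^\top$, $\sigma(\mu)e_3^\top$, $e_4^\top$, $\sigma(\nu)e_4^\top$ if this argument is $-a$, $|a|$, $-b$, $|b|$, $\mu$, $|\mu|$, $\nu$, $|\nu|$, respectively. Further: - if $D\varphi_1(w)=\pm e_1^\top$: $\varphi_2(w)=\min(|b|,|\nu|)$,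 and $D\varphi_2(w)=\sigma(b)e_2^\top$ if $|b|\le|\nu|$, else $\sigma(\nu)e_4^\top$; - if $D\varphi_1(w)=\pm e_2^\top$: $\varphi_2(w)=\min(|a|,|\mu|)$, and $D\varphi_2(w)=\sigma(a)e_1^\top$ if $|a|\le|\mu|$, else $\sigma(\mu)e_3^\top$; - if $D\varphi_1(w)=\pm e_3^\top$: $\varphi_2(w)=|b|$, $D\varphi_2(w)=\sigma(b)e_2^\top$; - if $D\varphi_1(w)=\pm e_4^\top$: $\varphi_2(w)=|a|$, $D\varphi_2(w)=\sigma(a)e_1^\top$. Put $\varphi=(\varphi_1,\varphi_2)$ and let $D\varphi(w)\in\mathbb{R}^{2\times 4}$ have rows $D\varphi_1(w)$, $D\varphi_2(w)$. A function $T\colon\mathbb{R}^n\to\mathbb{R}^m$ is Newton differentiable of order $\infty$ on $K\subset\mathbb{R}^n$ with derivative $DT\colon\mathbb{R}^n\to\mathbb{R}^{m\times n}$ if for all $x\in K$ there is $\varepsilon_x>0$ such that $T(x+h)-T(x)-DT(x+h)h=0$ for all $h$ with $\|h\|\le\varepsilon_x$. *)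

theory Defs
  imports "HOL-Analysis.Analysis"
begin

text \<open>
  A point \<open>w = (a, b, \<mu>, \<nu>)\<close> is a vector of type \<open>real ^ 4\<close> with
  \<open>a = w $ 1\<close>, \<open>b = w $ 2\<close>, \<open>\<mu> = w $ 3\<close>, \<open>\<nu> = w $ 4\<close>. The unit vector
  \<open>e\<^sub>i\<close> is \<open>axis i 1\<close>, and a row in \<open>\<real>\<^bsup>1\<times>4\<^esup>\<close> is represented by a vector of type \<open>real ^ 4\<close>.
\<close>

definition M_set :: "(real ^ 4) set" where
  "M_set = {w. w $ 1 \<ge> 0 \<and> w $ 2 \<ge> 0 \<and> w $ 1 * w $ 2 = 0 \<and>
               w $ 1 * w $ 3 = 0 \<and> w $ 2 * w $ 4 = 0 \<and>
               (w $ 3 * w $ 4 = 0 \<or> (w $ 3 < 0 \<and> w $ 4 < 0))}"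

definition psi1 :: "real ^ 4 \<Rightarrow> real" where
  "psi1 w = max (- w $ 1) (max \<bar>w $ 2\<bar> \<bar>w $ 3\<bar>)"

definition psi2 :: "real ^ 4 \<Rightarrow> real" where
  "psi2 w = max (- w $ 2) (max \<bar>w $ 1\<bar> \<bar>w $ 4\<bar>)"

definition psi3 :: "real ^ 4 \<Rightarrow> real" where
  "psi3 w = max \<bar>w $ 1\<bar> (max \<bar>w $ 2\<bar> (max (w $ 3) (w $ 4)))"

definition phi1 :: "real ^ 4 \<Rightarrow> real" where
  "phi1 w = min (psi1 w) (min (psi2 w) (psi3 w))"

text \<open>Unlike \<^const>\<open>sgn\<close>, the sign function used here has the value 1 at 0.\<close>

definition sign1 :: "real \<Rightarrow> real" where
  "sign1 s = (if s \<ge> 0 then 1 else - 1)"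

text \<open>
  The order of the tests implements the priority rule: first the smallest \<open>i\<close> with
  \<open>\<psi>\<^sub>i w = \<phi>\<^sub>1 w\<close>, then the first argument attaining the maximum in \<open>\<psi>\<^sub>i w\<close>.
\<close>

definition Dphi1 :: "real ^ 4 \<Rightarrow> real ^ 4" where
  "Dphi1 w =
    (if psi1 w = phi1 w then
       (if - w $ 1 = psi1 w then - axis 1 1
        else if \<bar>w $ 2\<bar> = psi1 w then sign1 (w $ 2) *\<^sub>R axis 2 1
        else sign1 (w $ 3) *\<^sub>R axis 3 1)
     else if psi2 w = phi1 w then
       (if - w $ 2 = psi2 w then - axis 2 1
        else if \<bar>w $ 1\<bar> = psi2 w then sign1 (w $ 1) *\<^sub>R axis 1 1
        else sign1 (w $ 4) *\<^sub>R axis 4 1)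
     else
       (if \<bar>w $ 1\<bar> = psi3 w then sign1 (w $ 1) *\<^sub>R axis 1 1
        else if \<bar>w $ 2\<bar> = psi3 w then sign1 (w $ 2) *\<^sub>R axis 2 1
        else if w $ 3 = psi3 w then axis 3 1
        else axis 4 1))"

text \<open>
  \<^const>\<open>Dphi1\<close> only takes the values \<open>\<plusminus>e\<^sub>i\<close>, so the final \<open>else\<close> branch in the next two
  definitions is the case \<open>\<plusminus>e\<^sub>4\<close>.
\<close>

definition phi2 :: "real ^ 4 \<Rightarrow> real" where
  "phi2 w =
    (if Dphi1 w = axis 1 1 \<or> Dphi1 w = - axis 1 1 then min \<bar>w $ 2\<bar> \<bar>w $ 4\<bar>
     else if Dphi1 w = axis 2 1 \<or> Dphi1 w = - axis 2 1 then min \<bar>w $ 1\<bar> \<bar>w $ 3\<bar>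
     else if Dphi1 w = axis 3 1 \<or> Dphi1 w = - axis 3 1 then \<bar>w $ 2\<bar>
     else \<bar>w $ 1\<bar>)"

definition Dphi2 :: "real ^ 4 \<Rightarrow> real ^ 4" where
  "Dphi2 w =
    (if Dphi1 w = axis 1 1 \<or> Dphi1 w = - axis 1 1 then
       (if \<bar>w $ 2\<bar> \<le> \<bar>w $ 4\<bar> then sign1 (w $ 2) *\<^sub>R axis 2 1
        else sign1 (w $ 4) *\<^sub>R axis 4 1)
     else if Dphi1 w = axis 2 1 \<or> Dphi1 w = - axis 2 1 then
       (if \<bar>w $ 1\<bar> \<le> \<bar>w $ 3\<bar> then sign1 (w $ 1) *\<^sub>R axis 1 1
        else sign1 (w $ 3) *\<^sub>R axis 3 1)
     else if Dphi1 w = axis 3 1 \<or> Dphi1 w = - axis 3 1 then sign1 (w $ 2) *\<^sub>R axis 2 1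
     else sign1 (w $ 1) *\<^sub>R axis 1 1)"

definition phi :: "real ^ 4 \<Rightarrow> real ^ 2" where
  "phi w = vector [phi1 w, phi2 w]"

definition Dphi :: "real ^ 4 \<Rightarrow> real ^ 4 ^ 2" where
  "Dphi w = vector [Dphi1 w, Dphi2 w]"

definition newton_differentiable_infty_on ::
    "(real ^ 'n \<Rightarrow> real ^ 'm) \<Rightarrow> (real ^ 'n \<Rightarrow> real ^ 'n ^ 'm) \<Rightarrow> (real ^ 'n) set \<Rightarrow> bool" where
  "newton_differentiable_infty_on T DT K \<longleftrightarrow>
     (\<forall>x\<in>K. \<exists>\<epsilon>>0. \<forall>h. norm h \<le> \<epsilon> \<longrightarrow> T (x + h) - T x - DT (x + h) *v h = 0)"

end

theory Submission
  imports Defs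
begin

text \<open>
  At every point, \<^const>\<open>phi1\<close> and \<^const>\<open>phi2\<close> are, up to signs, two different coordinates of
  the argument, and the rows of \<^const>\<open>Dphi\<close> are the corresponding signed unit vectors. So
  \<open>phi v = Dphi v *v v\<close> for every \<open>v\<close>. Let \<open>w\<close> lie in \<^const>\<open>M_set\<close> and \<open>v\<close> close to
  \<open>w\<close>. If both selected coordinates of \<open>w\<close> are zero, then \<open>phi v = Dphi v *v (v - w)\<close>. This
  gives Newton differentiability of infinite order, and also calmness with modulus 1, because
  two distinct coordinates of \<open>v - w\<close> have Euclidean norm at most \<^term>\<open>norm (v - w)\<close>.

  It remains to see that the selected coordinates vanish at \<open>w\<close>. As \<^term>\<open>w $ i\<close> is either zero
  or bounded away from zero, it suffices that the selected coordinates of \<open>v\<close> are small, that is,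
  that \<^term>\<open>phi1 v\<close> and \<^term>\<open>phi2 v\<close> are at most \<^term>\<open>norm (v - w)\<close>. For
  \<^const>\<open>phi1\<close> this is a Lipschitz estimate (\<open>phi1_lipschitz\<close>) together with the fact that
  \<^const>\<open>phi1\<close> alone already has \<^const>\<open>M_set\<close> as its zero set (\<open>phi1_eq_0_iff\<close>). For
  \<^const>\<open>phi2\<close>, knowing which coordinate of \<open>w\<close> the first row selects leaves a
  complementarity condition of \<^const>\<open>M_set\<close> that forces a candidate of \<^const>\<open>phi2\<close> to vanish
  at \<open>w\<close> (\<open>phi2_le_near_M\<close>).

  Limits inherit the zeros because \<^const>\<open>phi1\<close> is continuous and has the same zeros as
  \<^const>\<open>phi\<close>. The function \<^const>\<open>phi2\<close>
  jumps where the first row switches from \<open>- e\<^sub>1\<close> to \<open>e\<^sub>2\<close>, and such switching points exist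
  arbitrarily close to the origin, which lies in \<^const>\<open>M_set\<close> (\<open>phi2_jump\<close>).
\<close>

section \<open>Zeros\<close>

lemma psi_nonneg: "0 \<le> psi1 w" "0 \<le> psi2 w" "0 \<le> psi3 w"
  by (simp_all add: psi1_def psi2_def psi3_def le_max_iff_disj)

lemma phi1_nonneg: "0 \<le> phi1 w"
  using psi_nonneg[of w] by (simp add: phi1_def)

text \<open>
  The three functions \<open>\<psi>\<^sub>i\<close> vanish on the three pieces of \<^const>\<open>M_set\<close>: the points with
  \<open>b = \<mu> = 0 \<le> a\<close>, those with \<open>a = \<nu> = 0 \<le> b\<close>, and those with \<open>a = b = 0\<close> and
  \<open>\<mu>, \<nu> \<le> 0\<close>. A nonnegative minimum is zero when one of its arguments is.
\<close>
lemma phi1_eq_0_iff: "phi1 w = 0 \<longleftrightarrow> w \<in> M_set"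
proof -
  have "phi1 w = 0 \<longleftrightarrow> psi1 w = 0 \<or> psi2 w = 0 \<or> psi3 w = 0"
    using psi_nonneg[of w] unfolding phi1_def by linarith
  also have "psi1 w = 0 \<longleftrightarrow> w $ 1 \<ge> 0 \<and> w $ 2 = 0 \<and> w $ 3 = 0"
    unfolding psi1_def by linarith
  also have "psi2 w = 0 \<longleftrightarrow> w $ 2 \<ge> 0 \<and> w $ 1 = 0 \<and> w $ 4 = 0"
    unfolding psi2_def by linarith
  also have "psi3 w = 0 \<longleftrightarrow> w $ 1 = 0 \<and> w $ 2 = 0 \<and> w $ 3 \<le> 0 \<and> w $ 4 \<le> 0"
    unfolding psi3_def by linarith
  also have "(w $ 1 \<ge> 0 \<and> w $ 2 = 0 \<and> w $ 3 = 0) \<or> (w $ 2 \<ge> 0 \<and> w $ 1 = 0 \<and> w $ 4 = 0) \<or>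
      (w $ 1 = 0 \<and> w $ 2 = 0 \<and> w $ 3 \<le> 0 \<and> w $ 4 \<le> 0) \<longleftrightarrow> w \<in> M_set"
    unfolding M_set_def by auto
  finally show ?thesis .
qed

text \<open>
  All arguments of the maxima and minima are 1-Lipschitz in a single coordinate, and maxima and
  minima preserve this.
\<close>
lemma phi1_lipschitz: "phi1 v \<le> phi1 w + norm (v - w)"
proof -
  have comp: "\<bar>v $ i - w $ i\<bar> \<le> norm (v - w)" for i
    using component_le_norm_cart[of "v - w" i] by simp
  have abs: "\<bar>v $ i\<bar> \<le> \<bar>w $ i\<bar> + norm (v - w)" "- v $ i \<le> - w $ i + norm (v - w)"
    "v $ i \<le> w $ i + norm (v - w)" for i
    using comp[of i] by linarith+
  have max: "max p q \<le> max p' q' + x" if "p \<le> p' + x" "q \<le> q' + x" for p p' q q' x :: real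
    using that by linarith
  have "psi1 v \<le> psi1 w + norm (v - w)" unfolding psi1_def by (intro max abs)
  moreover have "psi2 v \<le> psi2 w + norm (v - w)" unfolding psi2_def by (intro max abs)
  moreover have "psi3 v \<le> psi3 w + norm (v - w)" unfolding psi3_def by (intro max abs)
  ultimately show ?thesis unfolding phi1_def by linarith
qed

section \<open>The coordinates selected by the derivative\<close>

lemma abs_sign1: "\<bar>sign1 s\<bar> = 1" "sign1 s * s = \<bar>s\<bar>"
  by (auto simp: sign1_def)

text \<open>
  The last two conjuncts record what is known when \<open>\<mu>\<close> or \<open>\<nu>\<close> is selected: in each maximum that
  contains \<open>\<mu>\<close> the number \<open>|b|\<close> also occurs, and in each that contains \<open>\<nu>\<close> so does \<open>|a|\<close>.
  These are the values of \<^const>\<open>phi2\<close> in these two cases, which \<^const>\<open>phi1\<close> therefore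
  bounds.
\<close>
lemma Dphi1_selects:
  "\<exists>i s. \<bar>s\<bar> = 1 \<and> Dphi1 v = s *\<^sub>R axis i 1 \<and> phi1 v = s * v $ i \<and>
         (i = 3 \<longrightarrow> \<bar>v $ 2\<bar> \<le> phi1 v) \<and> (i = 4 \<longrightarrow> \<bar>v $ 1\<bar> \<le> phi1 v)"
    (is "\<exists>i s. ?P i s")
proof -
  have max1: "\<bar>v $ 2\<bar> \<le> psi1 v" "- v $ 1 = psi1 v \<or> \<bar>v $ 2\<bar> = psi1 v \<or> \<bar>v $ 3\<bar> = psi1 v"
    by (simp_all add: psi1_def le_max_iff_disj max_def)
  have max2: "\<bar>v $ 1\<bar> \<le> psi2 v" "- v $ 2 = psi2 v \<or> \<bar>v $ 1\<bar> = psi2 v \<or> \<bar>v $ 4\<bar> = psi2 v"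
    by (simp_all add: psi2_def le_max_iff_disj max_def)
  have max3: "\<bar>v $ 1\<bar> \<le> psi3 v" "\<bar>v $ 2\<bar> \<le> psi3 v"
    "\<bar>v $ 1\<bar> = psi3 v \<or> \<bar>v $ 2\<bar> = psi3 v \<or> v $ 3 = psi3 v \<or> v $ 4 = psi3 v"
    by (simp_all add: psi3_def le_max_iff_disj max_def)
  have min: "psi1 v = phi1 v \<or> psi2 v = phi1 v \<or> psi3 v = phi1 v"
    unfolding phi1_def by linarith
  have sign: "\<exists>i s. ?P i s"
    if "\<bar>v $ i\<bar> = phi1 v" "Dphi1 v = sign1 (v $ i) *\<^sub>R axis i 1"
      "i = 3 \<Longrightarrow> \<bar>v $ 2\<bar> \<le> phi1 v" "i = 4 \<Longrightarrow> \<bar>v $ 1\<bar> \<le> phi1 v" for i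
    using that abs_sign1[of "v $ i"] by (intro exI[of _ i] exI[of _ "sign1 (v $ i)"]) simp
  have plain: "\<exists>i s. ?P i s"
    if "\<bar>s\<bar> = 1" "s * v $ i = phi1 v" "Dphi1 v = s *\<^sub>R axis i 1"
      "i = 3 \<Longrightarrow> \<bar>v $ 2\<bar> \<le> phi1 v" "i = 4 \<Longrightarrow> \<bar>v $ 1\<bar> \<le> phi1 v" for i s
    using that by (intro exI[of _ i] exI[of _ s]) simp
  \<comment> \<open>Stated for arbitrary conditions, so that no arithmetic on the absolute values is triggered.
    In the case of \<^const>\<open>psi3\<close> the value \<open>r\<close> is itself a conditional.\<close>
  have first: "(A \<and> x = p) \<or> (B \<and> x = q) \<or> (C \<and> x = r)"
    if "x = (if A then p else if B then q else r)" "A \<or> B \<or> C" for A B C and x p q r :: "real ^ 4"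
    using that by presburger
  consider "psi1 v = phi1 v" | "psi1 v \<noteq> phi1 v" "psi2 v = phi1 v"
    | "psi1 v \<noteq> phi1 v" "psi2 v \<noteq> phi1 v" "psi3 v = phi1 v"
    using min by blast
  thus ?thesis
  proof cases
    case 1
    note max = max1[unfolded 1]
    have "Dphi1 v = (if - v $ 1 = phi1 v then (-1) *\<^sub>R axis 1 1
        else if \<bar>v $ 2\<bar> = phi1 v then sign1 (v $ 2) *\<^sub>R axis 2 1
        else sign1 (v $ 3) *\<^sub>R axis 3 1)"
      unfolding Dphi1_def 1 by simp
    from first[OF this max(2)] show ?thesis
    proof (elim disjE conjE)
      assume "- v $ 1 = phi1 v" "Dphi1 v = (-1) *\<^sub>R axis 1 1"
      thus ?thesis by (intro plain[of "-1" 1]) simp_all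
    next
      assume "\<bar>v $ 2\<bar> = phi1 v" "Dphi1 v = sign1 (v $ 2) *\<^sub>R axis 2 1"
      thus ?thesis by (rule sign) simp_all
    next
      assume "\<bar>v $ 3\<bar> = phi1 v" "Dphi1 v = sign1 (v $ 3) *\<^sub>R axis 3 1"
      thus ?thesis by (rule sign) (simp_all add: max(1))
    qed
  next
    case 2
    note max = max2[unfolded 2]
    have "Dphi1 v = (if - v $ 2 = phi1 v then (-1) *\<^sub>R axis 2 1
        else if \<bar>v $ 1\<bar> = phi1 v then sign1 (v $ 1) *\<^sub>R axis 1 1
        else sign1 (v $ 4) *\<^sub>R axis 4 1)"
      unfolding Dphi1_def 2(2) using 2(1) by simp
    from first[OF this max(2)] show ?thesis
    proof (elim disjE conjE)
      assume "- v $ 2 = phi1 v" "Dphi1 v = (-1) *\<^sub>R axis 2 1"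
      thus ?thesis by (intro plain[of "-1" 2]) simp_all
    next
      assume "\<bar>v $ 1\<bar> = phi1 v" "Dphi1 v = sign1 (v $ 1) *\<^sub>R axis 1 1"
      thus ?thesis by (rule sign) simp_all
    next
      assume "\<bar>v $ 4\<bar> = phi1 v" "Dphi1 v = sign1 (v $ 4) *\<^sub>R axis 4 1"
      thus ?thesis by (rule sign) (simp_all add: max(1))
    qed
  next
    case 3
    note max = max3[unfolded 3(3)]
    have D: "Dphi1 v = (if \<bar>v $ 1\<bar> = phi1 v then sign1 (v $ 1) *\<^sub>R axis 1 1
        else if \<bar>v $ 2\<bar> = phi1 v then sign1 (v $ 2) *\<^sub>R axis 2 1
        else if v $ 3 = phi1 v then 1 *\<^sub>R axis 3 1 else 1 *\<^sub>R axis 4 1)"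
      unfolding Dphi1_def 3(3) using 3(1,2) by simp
    from first[OF this max(3)] show ?thesis
    proof (elim disjE conjE)
      assume "\<bar>v $ 1\<bar> = phi1 v" "Dphi1 v = sign1 (v $ 1) *\<^sub>R axis 1 1"
      thus ?thesis by (rule sign) simp_all
    next
      assume "\<bar>v $ 2\<bar> = phi1 v" "Dphi1 v = sign1 (v $ 2) *\<^sub>R axis 2 1"
      thus ?thesis by (rule sign) simp_all
    next
      assume d: "v $ 3 = phi1 v"
        "Dphi1 v = (if v $ 3 = phi1 v then 1 *\<^sub>R axis 3 1 else 1 *\<^sub>R axis 4 1)"
      show ?thesis by (rule plain[of 1 3]) (use d max(2) in simp_all)
    next
      assume d: "v $ 4 = phi1 v"
        "Dphi1 v = (if v $ 3 = phi1 v then 1 *\<^sub>R axis 3 1 else 1 *\<^sub>R axis 4 1)"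
      show ?thesis
      proof (cases "v $ 3 = phi1 v")
        case True
        show ?thesis by (rule plain[of 1 3]) (use d(2) True max(2) in simp_all)
      next
        case False
        show ?thesis by (rule plain[of 1 4]) (use d False max(1) in simp_all)
      qed
    qed
  qed
qed

text \<open>
  The signed unit vectors in different directions are distinct, so the case distinction on
  \<^const>\<open>Dphi1\<close> is one on \<open>i\<close>. In each case the candidates for \<open>j\<close> exclude \<open>i\<close>.
\<close>
lemma phi2_selects:
  assumes "\<bar>s\<bar> = 1" "Dphi1 v = s *\<^sub>R axis i 1"
  shows "\<exists>j r. j \<noteq> i \<and> \<bar>r\<bar> = 1 \<and> Dphi2 v = r *\<^sub>R axis j 1 \<and> phi2 v = r * v $ j"
    and "phi2 v = (if i = 1 then min \<bar>v $ 2\<bar> \<bar>v $ 4\<bar> else if i = 2 then min \<bar>v $ 1\<bar> \<bar>v $ 3\<bar>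
                   else if i = 3 then \<bar>v $ 2\<bar> else \<bar>v $ 1\<bar>)"
proof -
  have row: "(Dphi1 v = axis k 1 \<or> Dphi1 v = - axis k 1) \<longleftrightarrow> i = k" for k
  proof -
    have "s = 1 \<or> s = -1" using assms(1) by linarith
    moreover have "(- axis i 1 :: real^4) \<noteq> axis k 1"
    proof
      assume "(- axis i 1 :: real^4) = axis k 1"
      hence "(- axis i 1 :: real^4) $ i = axis k 1 $ i" by simp
      thus False by (simp add: axis_def split: if_splits)
    qed
    ultimately show ?thesis
      using assms(2) by (auto simp: axis_eq_axis minus_equation_iff)
  qed
  show val: "phi2 v = (if i = 1 then min \<bar>v $ 2\<bar> \<bar>v $ 4\<bar> else if i = 2 then min \<bar>v $ 1\<bar> \<bar>v $ 3\<bar>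
                   else if i = 3 then \<bar>v $ 2\<bar> else \<bar>v $ 1\<bar>)"
    unfolding phi2_def row by simp
  define j where "j = (if i = 1 then if \<bar>v $ 2\<bar> \<le> \<bar>v $ 4\<bar> then 2 else 4
    else if i = 2 then if \<bar>v $ 1\<bar> \<le> \<bar>v $ 3\<bar> then 1 else 3
    else if i = 3 then 2 else (1::4))"
  have "j \<noteq> i" using exhaust_4[of i] by (auto simp: j_def)
  moreover have "Dphi2 v = sign1 (v $ j) *\<^sub>R axis j 1"
    unfolding Dphi2_def row j_def by auto
  moreover have "phi2 v = sign1 (v $ j) * v $ j"
    unfolding val j_def by (auto simp: abs_sign1)
  ultimately show "\<exists>j r. j \<noteq> i \<and> \<bar>r\<bar> = 1 \<and> Dphi2 v = r *\<^sub>R axis j 1 \<and> phi2 v = r * v $ j"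
    using abs_sign1(1) by blast
qed

lemma phi2_nonneg: "0 \<le> phi2 w"
  unfolding phi2_def by simp

text \<open>
  If the first row selects \<open>a\<close> or \<open>b\<close>, then this coordinate is zero at \<open>w\<close>, and the two candidates
  in the minimum defining \<^const>\<open>phi2\<close> have product zero at \<open>w\<close>: \<open>b\<nu> = 0\<close> or \<open>a\<mu> = 0\<close>,
  respectively. So one of them vanishes at \<open>w\<close> and is small at \<open>v\<close>. If \<open>\<mu>\<close> or \<open>\<nu>\<close> is selected,
  \<^const>\<open>phi2\<close> is bounded by \<^const>\<open>phi1\<close>.
\<close>
lemma phi2_le_near_M:
  assumes sel: "\<bar>s\<bar> = 1" "Dphi1 v = s *\<^sub>R axis i 1"
    and bounds: "i = 3 \<longrightarrow> \<bar>v $ 2\<bar> \<le> phi1 v" "i = 4 \<longrightarrow> \<bar>v $ 1\<bar> \<le> phi1 v"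
    and w: "w \<in> M_set" "w $ i = 0"
  shows "phi2 v \<le> norm (v - w)"
proof -
  have comp: "w $ k = 0 \<Longrightarrow> \<bar>v $ k\<bar> \<le> norm (v - w)" for k
    using component_le_norm_cart[of "v - w" k] by simp
  have phi1_le: "phi1 v \<le> norm (v - w)"
    using phi1_lipschitz[of v w] w(1) by (simp add: phi1_eq_0_iff[symmetric])
  have M: "w $ 2 * w $ 4 = 0" "w $ 1 * w $ 3 = 0"
    using w(1) by (auto simp: M_set_def)
  consider "i = 1" | "i = 2" | "i = 3" | "i = 4" using exhaust_4[of i] by blast
  thus ?thesis
  proof cases
    case 1
    moreover have "min \<bar>v $ 2\<bar> \<bar>v $ 4\<bar> \<le> norm (v - w)"
      using M(1) comp[of 2] comp[of 4] by auto
    ultimately show ?thesis using phi2_selects(2)[OF sel] by simp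
  next
    case 2
    moreover have "min \<bar>v $ 1\<bar> \<bar>v $ 3\<bar> \<le> norm (v - w)"
      using M(2) comp[of 1] comp[of 3] by auto
    ultimately show ?thesis using phi2_selects(2)[OF sel] by simp
  next
    case 3
    thus ?thesis using phi2_selects(2)[OF sel] bounds phi1_le by simp
  next
    case 4
    thus ?thesis using phi2_selects(2)[OF sel] bounds phi1_le by simp
  qed
qed

lemma nonzero_components_bounded_away:
  fixes w :: "real ^ 'n"
  obtains e where "e > 0" "\<And>i. \<bar>w $ i\<bar> \<le> 2 * e \<Longrightarrow> w $ i = 0"
proof -
  \<comment> \<open>The element 1 keeps the set nonempty when \<open>w = 0\<close>; dividing by 3 gives the strict
    inequality that contradicts \<open>\<bar>w $ i\<bar> \<le> 2 * e\<close>.\<close>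
  define S where "S = insert 1 ((\<lambda>i. \<bar>w $ i\<bar> / 3) ` {i. w $ i \<noteq> 0})"
  have S: "finite S" "S \<noteq> {}" by (auto simp: S_def)
  have "Min S > 0" using S by (auto simp: S_def)
  moreover have "w $ i = 0" if le: "\<bar>w $ i\<bar> \<le> 2 * Min S" for i
  proof (rule ccontr)
    assume "w $ i \<noteq> 0"
    hence "Min S \<le> \<bar>w $ i\<bar> / 3" using S by (intro Min_le) (auto simp: S_def)
    with le \<open>w $ i \<noteq> 0\<close> show False by linarith
  qed
  ultimately show ?thesis using that by blast
qed

text \<open>
  The coordinates of \<open>v\<close> that \<^const>\<open>phi\<close> reads off vanish at the reference point \<open>w\<close>. This is
  what makes the linearization at \<open>v\<close> exact: \<^term>\<open>Dphi v\<close> annihilates \<open>w\<close>, so that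
  \<^term>\<open>Dphi v *v (v - w)\<close> is \<^term>\<open>phi v\<close>.
\<close>
definition reads_zero_coordinates :: "real ^ 4 \<Rightarrow> real ^ 4 \<Rightarrow> bool" where
  "reads_zero_coordinates w v \<longleftrightarrow> (\<exists>i j s r. i \<noteq> j \<and> \<bar>s\<bar> = 1 \<and> \<bar>r\<bar> = 1 \<and> w $ i = 0 \<and> w $ j = 0 \<and>
      Dphi1 v = s *\<^sub>R axis i 1 \<and> phi1 v = s * v $ i \<and>
      Dphi2 v = r *\<^sub>R axis j 1 \<and> phi2 v = r * v $ j)"

text \<open>
  The radius is chosen so that every nonzero coordinate of \<open>w\<close> exceeds \<open>2 * e\<close> in absolute value.
  A selected coordinate of \<open>v\<close> equals \<^term>\<open>phi1 v\<close> or \<^term>\<open>phi2 v\<close> up to sign and hence is at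
  most \<^term>\<open>norm (v - w)\<close>. The same coordinate of \<open>w\<close> is then at most twice this distance, so
  it is zero.
\<close>
lemma phi_selects_vanishing_coordinates:
  assumes "w \<in> M_set"
  obtains e where "e > 0" "\<And>v. norm (v - w) \<le> e \<Longrightarrow> reads_zero_coordinates w v"
proof -
  obtain e where e: "e > 0" "\<And>i. \<bar>w $ i\<bar> \<le> 2 * e \<Longrightarrow> w $ i = 0"
    using nonzero_components_bounded_away[of w] by blast
  show ?thesis
  proof (rule that[OF e(1)])
    fix v assume le: "norm (v - w) \<le> e"
    have vanish: "w $ k = 0" if "\<bar>v $ k\<bar> \<le> norm (v - w)" for k
    proof (rule e(2))
      show "\<bar>w $ k\<bar> \<le> 2 * e"
        using that le component_le_norm_cart[of "v - w" k] by simp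
    qed
    obtain i s where s: "\<bar>s\<bar> = 1" "Dphi1 v = s *\<^sub>R axis i 1" "phi1 v = s * v $ i"
      and bounds: "i = 3 \<longrightarrow> \<bar>v $ 2\<bar> \<le> phi1 v" "i = 4 \<longrightarrow> \<bar>v $ 1\<bar> \<le> phi1 v"
      using Dphi1_selects[of v] by blast
    obtain j r where r: "j \<noteq> i" "\<bar>r\<bar> = 1" "Dphi2 v = r *\<^sub>R axis j 1" "phi2 v = r * v $ j"
      using phi2_selects(1)[OF s(1,2)] by blast
    have "\<bar>v $ i\<bar> = phi1 v"
      using s phi1_nonneg[of v] by (metis abs_mult abs_of_nonneg mult_1)
    also have "\<dots> \<le> norm (v - w)"
      using phi1_lipschitz[of v w] assms by (simp add: phi1_eq_0_iff[symmetric])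
    finally have i0: "w $ i = 0" by (rule vanish)
    have "\<bar>v $ j\<bar> = phi2 v"
      using r phi2_nonneg[of v] by (metis abs_mult abs_of_nonneg mult_1)
    also have "\<dots> \<le> norm (v - w)"
      using phi2_le_near_M[OF s(1,2) bounds assms i0] .
    finally have j0: "w $ j = 0" by (rule vanish)
    show "reads_zero_coordinates w v"
      unfolding reads_zero_coordinates_def using s r(2-4) r(1)[symmetric] i0 j0 by (intro exI conjI)
  qed
qed

text \<open>
  On \<^const>\<open>M_set\<close> the vanishing of \<^const>\<open>phi2\<close> is the case \<open>v = w\<close> of the preceding lemma.
\<close>
lemma phi_eq_0_iff: "phi w = 0 \<longleftrightarrow> w \<in> M_set"
proof
  assume "phi w = 0"
  hence "phi w $ 1 = 0" by simp
  thus "w \<in> M_set" by (simp add: phi_def phi1_eq_0_iff)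
next
  assume w: "w \<in> M_set"
  then obtain e where "e > 0" and e: "\<And>v. norm (v - w) \<le> e \<Longrightarrow> reads_zero_coordinates w v"
    by (rule phi_selects_vanishing_coordinates) blast
  have "phi1 w = 0 \<and> phi2 w = 0"
    using e[of w] \<open>e > 0\<close> by (auto simp: reads_zero_coordinates_def)
  thus "phi w = 0" by (simp add: phi_def vec_eq_iff forall_2)
qed

section \<open>Behaviour near the zero set\<close>

lemma phi_newton_differentiable: "newton_differentiable_infty_on phi Dphi M_set"
  unfolding newton_differentiable_infty_on_def
proof
  fix w assume w: "w \<in> M_set"
  then obtain e where "e > 0" and e: "\<And>v. norm (v - w) \<le> e \<Longrightarrow> reads_zero_coordinates w v"
    by (rule phi_selects_vanishing_coordinates) blast
  have "phi (w + h) - phi w - Dphi (w + h) *v h = 0" if h: "norm h \<le> e" for h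
  proof -
    obtain i j s r where "w $ i = 0" "w $ j = 0"
      "Dphi1 (w + h) = s *\<^sub>R axis i 1" "phi1 (w + h) = s * (w + h) $ i"
      "Dphi2 (w + h) = r *\<^sub>R axis j 1" "phi2 (w + h) = r * (w + h) $ j"
      using e[of "w + h"] h by (auto simp: reads_zero_coordinates_def)
    moreover have "phi w = 0" using w by (simp add: phi_eq_0_iff)
    ultimately show ?thesis
      by (subst vec_eq_iff)
        (simp add: phi_def Dphi_def forall_2 matrix_vector_mul_component inner_axis')
  qed
  thus "\<exists>e>0. \<forall>h. norm h \<le> e \<longrightarrow> phi (w + h) - phi w - Dphi (w + h) *v h = 0"
    using \<open>e > 0\<close> by blast
qed

lemma phi_calm:
  assumes "w \<in> M_set"
  shows "\<exists>U. open U \<and> w \<in> U \<and> (\<forall>v\<in>U. norm (phi v - phi w) \<le> norm (v - w))"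
proof -
  obtain e where "e > 0" and e: "\<And>v. norm (v - w) \<le> e \<Longrightarrow> reads_zero_coordinates w v"
    using assms by (rule phi_selects_vanishing_coordinates) blast
  have "norm (phi v - phi w) \<le> norm (v - w)" if "v \<in> ball w e" for v
  proof -
    have "norm (v - w) \<le> e" using that by (simp add: dist_norm norm_minus_commute)
    then obtain i j s r where sel: "i \<noteq> j" "\<bar>s\<bar> = 1" "\<bar>r\<bar> = 1" "w $ i = 0" "w $ j = 0"
      "phi1 v = s * v $ i" "phi2 v = r * v $ j"
      using e unfolding reads_zero_coordinates_def by blast
    have unit: "s\<^sup>2 = 1" "r\<^sup>2 = 1"
      using sel(2,3) by (metis power2_abs one_power2)+
    have "phi w = 0" using assms by (simp add: phi_eq_0_iff)
    hence "norm (phi v - phi w) = sqrt ((phi1 v)\<^sup>2 + (phi2 v)\<^sup>2)"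
      by (simp add: norm_vec_def L2_set_def sum_2 phi_def)
    also have "(phi1 v)\<^sup>2 + (phi2 v)\<^sup>2 = (\<Sum>k\<in>{i, j}. ((v - w) $ k)\<^sup>2)"
      using sel by (simp add: power_mult_distrib unit)
    also have "sqrt \<dots> \<le> sqrt (\<Sum>k\<in>UNIV. ((v - w) $ k)\<^sup>2)"
      by (intro real_sqrt_le_mono sum_mono2) auto
    also have "\<dots> = norm (v - w)" by (simp add: norm_vec_def L2_set_def)
    finally show ?thesis .
  qed
  thus ?thesis using \<open>e > 0\<close> by (intro exI[of _ "ball w e"]) auto
qed

section \<open>Discontinuity\<close>

text \<open>
  The three maxima stay equal to \<open>t\<close> along this segment, so \<^const>\<open>phi1\<close> is constant and the first
  row comes from the first argument attaining the maximum in \<^const>\<open>psi1\<close>. At \<open>s = 0\<close> the argument \<open>- a\<close>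
  attains the maximum and \<^const>\<open>phi2\<close> is \<open>min |b| |\<nu>| = t\<close>. For \<open>s > 0\<close> the argument \<open>|b|\<close>
  is the first to attain it, and \<^const>\<open>phi2\<close> is \<open>min |a| |\<mu>| = 0\<close>.
\<close>
lemma phi2_jump:
  fixes w :: "real ^ 4"
  assumes "t > 0" "0 \<le> s" "s \<le> t"
    and "w $ 1 = s - t" "w $ 2 = t" "w $ 3 = 0" "w $ 4 = t"
  shows "phi2 w = (if s = 0 then t else 0)"
proof -
  have psi: "psi1 w = t" "phi1 w = t"
    using assms by (simp_all add: phi1_def psi1_def psi2_def psi3_def)
  show ?thesis
  proof (cases "s = 0")
    case True
    hence "Dphi1 w = (-1) *\<^sub>R axis 1 1" unfolding Dphi1_def using psi assms by simp
    thus ?thesis using phi2_selects(2)[of "-1" w 1] True assms by simp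
  next
    case False
    hence "Dphi1 w = 1 *\<^sub>R axis 2 1" unfolding Dphi1_def using psi assms
      by (simp add: sign1_def)
    thus ?thesis using phi2_selects(2)[of 1 w 2] False assms by simp
  qed
qed

lemma phi_not_continuous:
  assumes "open U" "M_set \<subseteq> U"
  shows "\<not> continuous_on U phi"
proof
  assume cont: "continuous_on U phi"
  \<comment> \<open>The segment of the preceding lemma; its initial point \<open>c t 0\<close> tends to the origin as
    \<open>t\<close> tends to 0.\<close>
  define c :: "real \<Rightarrow> real \<Rightarrow> real ^ 4"
    where "c t s = (s - t) *\<^sub>R axis 1 1 + t *\<^sub>R axis 2 1 + t *\<^sub>R axis 4 1" for t s
  have c: "c t s $ 1 = s - t" "c t s $ 2 = t" "c t s $ 3 = 0" "c t s $ 4 = t" for t s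
    by (simp_all add: c_def axis_def)
  have "0 \<in> U" using assms(2) by (auto simp: M_set_def)
  have "((\<lambda>t. c t 0) \<longlongrightarrow> c 0 0) (at_right 0)"
    unfolding c_def by (intro tendsto_intros)
  hence "\<forall>\<^sub>F t in at_right 0. c t 0 \<in> U"
    using assms(1) by (rule topological_tendstoD) (simp add: c_def \<open>0 \<in> U\<close>)
  hence "\<forall>\<^sub>F t in at_right 0. c t 0 \<in> U \<and> t > (0::real)"
    using eventually_at_right_less by (rule eventually_conj)
  then obtain t where t: "c t 0 \<in> U" "t > 0"
    by (elim exE[OF eventually_happens'[OF trivial_limit_at_right_real]] conjE)
  have jump: "phi (c t s) $ 2 = (if s = 0 then t else 0)" if "0 \<le> s" "s \<le> t" for s
    using phi2_jump[OF t(2) that c] by (simp add: phi_def)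
  have "isCont phi (c t 0)"
    using cont t(1) unfolding continuous_on_eq_continuous_at[OF assms(1)] by (rule bspec)
  moreover have "((\<lambda>s. c t s) \<longlongrightarrow> c t 0) (at_right 0)"
    unfolding c_def by (intro tendsto_intros)
  ultimately have "((\<lambda>s. phi (c t s)) \<longlongrightarrow> phi (c t 0)) (at_right 0)"
    by (rule isCont_tendsto_compose)
  hence "((\<lambda>s. phi (c t s) $ 2) \<longlongrightarrow> phi (c t 0) $ 2) (at_right 0)"
    by (rule tendsto_vec_nth)
  hence lim: "((\<lambda>s. phi (c t s) $ 2) \<longlongrightarrow> t) (at_right 0)"
    using jump[of 0] t(2) by simp
  have "\<forall>\<^sub>F s in at_right 0. phi (c t s) $ 2 = 0"
    unfolding eventually_at_right_field
  proof (intro exI[of _ t] conjI allI impI)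
    fix s :: real assume "0 < s" "s < t"
    thus "phi (c t s) $ 2 = 0" using jump[of s] by simp
  qed (rule t(2))
  hence "((\<lambda>s. phi (c t s) $ 2) \<longlongrightarrow> 0) (at_right 0)"
    by (rule tendsto_eventually)
  with lim have "t = 0"
    by (rule tendsto_unique[OF trivial_limit_at_right_real])
  with t(2) show False by simp
qed

text \<open>
  The Lipschitz estimate passes the limit 0 of \<^const>\<open>phi1\<close> on to \<open>v\<close>, and the zeros of
  \<^const>\<open>phi1\<close> are those of \<^const>\<open>phi\<close>.
\<close>
lemma phi_limit_zero:
  assumes "(\<lambda>k. phi (w k)) \<longlonglongrightarrow> 0" "w \<longlonglongrightarrow> v"
  shows "phi v = 0"
proof -
  have "(\<lambda>k. phi (w k) $ 1) \<longlonglongrightarrow> (0 :: real ^ 2) $ 1" using assms(1) by (rule tendsto_vec_nth)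
  hence "(\<lambda>k. phi1 (w k)) \<longlonglongrightarrow> 0" by (simp add: phi_def)
  hence "(\<lambda>k. phi1 (w k) + norm (v - w k)) \<longlonglongrightarrow> 0 + norm (v - v)"
    using assms(2) by (intro tendsto_intros)
  hence "phi1 v \<le> 0 + norm (v - v)"
    by (rule LIMSEQ_le_const) (intro exI allI impI phi1_lipschitz)
  hence "phi1 v = 0" using phi1_nonneg[of v] by simp
  thus ?thesis unfolding phi_eq_0_iff phi1_eq_0_iff .
qed

theorem lemma3p3:
  shows "(\<forall>w. phi w = 0 \<longleftrightarrow> w \<in> M_set) \<and>
    newton_differentiable_infty_on phi Dphi M_set \<and>
    (\<forall>U. open U \<and> M_set \<subseteq> U \<longrightarrow> \<not> continuous_on U phi) \<and>
    (\<forall>wbar\<in>M_set. \<exists>U. open U \<and> wbar \<in> U \<and>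
       (\<forall>w\<in>U. norm (phi w - phi wbar) \<le> norm (w - wbar))) \<and>
    (\<forall>(w :: nat \<Rightarrow> real ^ 4) wbar.
       (\<lambda>k. phi (w k)) \<longlonglongrightarrow> 0 \<and> w \<longlonglongrightarrow> wbar \<longrightarrow> phi wbar = 0)"
  by (intro conjI allI ballI impI; (elim conjE)?)
    (fact phi_eq_0_iff phi_newton_differentiable phi_not_continuous phi_calm phi_limit_zero)+

end
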